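(* Let $a,b,c\in[0,\infty)$ with $c>0$. There exists a function $G\in C^2([0,1])$ such that $$G(0)=0,\qquad G(1)=c,\qquad G'(0)=a,\qquad G'(1)=b,\qquad G'\ge 0 \text{ on } [0,1],$$ and $$\|G''\|_{L^\infty([0,1])}\le(1+c_0)\,\mathcal{M}^*(a,b,c),$$ where $c_0$ is a universal constant, which moreover may be taken to be $c_0=0.2$.
   Context: $C^{1,1}([0,1])$ denotes the space of differentiable functions on $[0,1]$ with Lipschitz derivative (equivalently $W^{2,\infty}([0,1])$), with second derivatives understood in the sense of distributions; $C^2([0,1])$ denotes the twice continuously differentiable functions. For real $a,b,c\ge 0$, $$\mathcal{M}^*(a,b,c):=\inf\left\{\|H''\|_{L^\infty([0,1])} : H\in C^{1,1}([0,1]),\ H(0)=0,\ H(1)=c,\ H'(0)=a,\ H'(1)=b,\ H'(x)\ge 0\ \forall x\in[0,1]\right\},$$ with the convention $\inf\varnothing=\infty$. Its explicit value is $\frac{a^2+b^2}{2c}$ if $0\le c\le\frac{a^2+b^2}{2(a+b)}$ and $|2c-a-b|+\sqrt{(2c-a-b)^2+(b-a)^2}$ if $c\ge\frac{a^2+b^2}{2(a+b)}$, with the convention $\frac00=0$ and $\frac{\varepsilon}{0}=\infty$ for $\varepsilon>0$. "Universal" means independent of $a,b,c$. *)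

theory Defs
  imports "HOL-Analysis.Analysis" "HOL-Probability.Essential_Supremum"
begin

text \<open>Derivative relative to the closed unit interval: one-sided at the two end points.\<close>

definition deriv01 :: "(real \<Rightarrow> real) \<Rightarrow> real \<Rightarrow> real" where
  "deriv01 f x = vector_derivative f (at x within {0..1})"

definition C11_on01 :: "(real \<Rightarrow> real) \<Rightarrow> bool" where
  "C11_on01 f \<longleftrightarrow> f differentiable_on {0..1} \<and> (\<exists>L. L-lipschitz_on {0..1} (deriv01 f))"

definition C2_on01 :: "(real \<Rightarrow> real) \<Rightarrow> bool" where
  "C2_on01 f \<longleftrightarrow> f differentiable_on {0..1} \<and> deriv01 f differentiable_on {0..1} \<and>
     continuous_on {0..1} (deriv01 (deriv01 f))"

definition Linf_norm01 :: "(real \<Rightarrow> real) \<Rightarrow> ennreal" where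
  "Linf_norm01 f = esssup (lebesgue_on {0..1}) (\<lambda>x. ennreal \<bar>f x\<bar>)"

text \<open>The test functions on \<open>(0,1)\<close>, extended by zero. The closed support is bounded,
  so its inclusion in the open interval makes it a compact subset of that interval.\<close>

definition test_functions01 :: "(real \<Rightarrow> real) set" where
  "test_functions01 =
     {\<phi>. (\<forall>n. (deriv ^^ n) \<phi> differentiable_on UNIV) \<and> closure {x. \<phi> x \<noteq> 0} \<subseteq> {0<..<1}}"

definition locally_integrable01 :: "(real \<Rightarrow> real) \<Rightarrow> bool" where
  "locally_integrable01 g \<longleftrightarrow>
     (\<forall>K. compact K \<and> K \<subseteq> {0<..<1} \<longrightarrow> integrable (lebesgue_on K) g)"

text \<open>The locally integrable function \<open>g\<close> represents \<open>H''\<close> in the sense of distributions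
  on \<open>(0,1)\<close>.\<close>

definition distr_deriv2_01 :: "(real \<Rightarrow> real) \<Rightarrow> (real \<Rightarrow> real) \<Rightarrow> bool" where
  "distr_deriv2_01 H g \<longleftrightarrow> locally_integrable01 g \<and>
     (\<forall>\<phi>\<in>test_functions01.
        (LINT x|lebesgue_on {0..1}. H x * deriv (deriv \<phi>) x) =
        (LINT x|lebesgue_on {0..1}. g x * \<phi> x))"

text \<open>A \<open>C\<^sup>1\<^sup>,\<^sup>1\<close> function has a distributional second derivative \<open>g\<close>, which is unique up to
  null sets, so quantifying over \<open>g\<close> excludes no competitor \<open>H\<close> and leaves the value
  \<open>Linf_norm01 g\<close> determined by \<open>H\<close>. The infimum of the empty set in \<open>ennreal\<close> is \<open>\<infinity>\<close>.\<close>

definition Mstar :: "real \<Rightarrow> real \<Rightarrow> real \<Rightarrow> ennreal" where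
  "Mstar a b c = Inf {Linf_norm01 g | H g.
     C11_on01 H \<and> distr_deriv2_01 H g \<and> H 0 = 0 \<and> H 1 = c \<and>
     deriv01 H 0 = a \<and> deriv01 H 1 = b \<and> (\<forall>x\<in>{0..1}. 0 \<le> deriv01 H x)}"

end

theory Submission
  imports Defs
begin

text \<open>A distributional second derivative bounded by \<open>k\<close> makes \<open>H'\<close> a \<open>k\<close>-Lipschitz
  function. Let \<open>p\<close> and \<open>q\<close> be the lengths of the two end intervals on which the slope of
  the extremal function is affine with derivative \<open>\<plusminus>M\<close>. Comparing \<open>H\<close> on these intervals
  with its quadratic Taylor bounds, and using \<open>H' \<ge> 0\<close> in between, gives \<open>M \<le> k\<close>, so
  \<open>M\<close> bounds \<open>\<M>\<^sup>*(a,b,c)\<close> from below. Conversely the admissible slopes with derivative bounded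
  by \<open>6 M / 5\<close> form a convex set on which the integral is affine, so a \<open>C\<^sup>2\<close> function with
  \<open>G(1) = c\<close> is an average of one with too small and one with too large a value at \<open>1\<close>.\<close>

subsection \<open>Smooth steps\<close>

text \<open>The powers in the denominator are exactly those that differentiation of exp(-1/x)
  creates, so derivatives stay in the linear span of this family.\<close>

definition flat :: "nat \<Rightarrow> real \<Rightarrow> real" where
  "flat i x = (if x \<le> 0 then 0 else exp (- 1 / x) / x ^ i)"

lemma flat_tendsto_0: "(flat i \<longlongrightarrow> 0) (at 0)"
proof -
  have "((\<lambda>x. inverse x ^ i / exp (inverse x)) \<longlongrightarrow> (0::real)) (at_right 0)"
    by (rule filterlim_compose[OF tendsto_power_div_exp_0 filterlim_inverse_at_top_right])
  moreover have "\<forall>\<^sub>F x in at_right 0. inverse x ^ i / exp (inverse x) = flat i x"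
    by (auto simp: flat_def eventually_at_right_less exp_minus power_inverse field_simps
        intro!: eventually_at_rightI[of 0 1])
  ultimately have right: "(flat i \<longlongrightarrow> 0) (at_right 0)"
    by (rule Lim_transform_eventually)
  have "\<forall>\<^sub>F x in at_left 0. 0 = flat i x"
    by (auto simp: flat_def intro!: eventually_at_leftI[of "-1"])
  then have "(flat i \<longlongrightarrow> 0) (at_left 0)"
    by (rule Lim_transform_eventually[OF tendsto_const])
  with right show ?thesis
    by (simp add: filterlim_split_at)
qed

lemma DERIV_flat: "(flat i has_real_derivative flat (i + 2) x - i * flat (i + 1) x) (at x)"
proof (cases "x = 0")
  case True
  \<comment> \<open>Dividing by \<open>h\<close> only raises the index, so the difference quotient
    at 0 is again a member of the family and tends to 0.\<close>
  have eq: "flat (Suc i) h = (flat i (0 + h) - flat i 0) / h" if "h \<noteq> 0" for h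
    using that by (simp add: flat_def)
  have "((\<lambda>h. (flat i (0 + h) - flat i 0) / h) \<longlongrightarrow> 0) (at 0)"
    by (rule Lim_transform_eventually[OF flat_tendsto_0[of "Suc i"]])
       (use eq in \<open>auto simp: eventually_at_filter\<close>)
  then show ?thesis
    using True by (simp add: DERIV_def flat_def)
next
  case False
  consider "x < 0" | "x > 0" using False by linarith
  then show ?thesis
  proof cases
    case 1
    have "((\<lambda>x. 0) has_real_derivative 0) (at x)" by simp
    then have "(flat i has_real_derivative 0) (at x)"
      by (rule has_field_derivative_transform_within_open[where S="{..<0}"])
         (use 1 in \<open>auto simp: flat_def\<close>)
    then show ?thesis using 1 by (simp add: flat_def)
  next
    case 2
    \<comment> \<open>For \<open>i = 0\<close> the truncated exponent is harmless: both sides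
      vanish.\<close>
    have *: "i * x ^ (i - 1) = i * x ^ i / x"
      using 2 by (cases i) auto
    have "((\<lambda>x. exp (- 1 / x) / x ^ i) has_real_derivative
        (exp (- 1 / x) * (1 / x\<^sup>2) * x ^ i - exp (- 1 / x) * (i * x ^ (i - 1))) / (x ^ i * x ^ i)) (at x)"
      using 2 by (auto intro!: derivative_eq_intros simp: power2_eq_square)
    moreover have "(exp (- 1 / x) * (1 / x\<^sup>2) * x ^ i - exp (- 1 / x) * (i * x ^ (i - 1))) / (x ^ i * x ^ i)
        = flat (i + 2) x - i * flat (i + 1) x"
      unfolding * using 2 by (simp add: flat_def field_simps power2_eq_square)
    ultimately have "((\<lambda>x. exp (- 1 / x) / x ^ i) has_real_derivative flat (i + 2) x - i * flat (i + 1) x) (at x)"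
      by simp
    then show ?thesis
      by (rule has_field_derivative_transform_within_open[where S="{0<..}"])
         (use 2 in \<open>auto simp: flat_def\<close>)
  qed
qed

text \<open>A class of functions closed under differentiation; all its members are therefore smooth.\<close>

inductive flat_algebra :: "(real \<Rightarrow> real) \<Rightarrow> bool" where
  flat: "flat_algebra (\<lambda>x. flat i (s * x + t))"
| const: "flat_algebra (\<lambda>x. c)"
| add: "flat_algebra f \<Longrightarrow> flat_algebra g \<Longrightarrow> flat_algebra (\<lambda>x. f x + g x)"
| mult: "flat_algebra f \<Longrightarrow> flat_algebra g \<Longrightarrow> flat_algebra (\<lambda>x. f x * g x)"

lemma flat_algebra_cmult: "flat_algebra f \<Longrightarrow> flat_algebra (\<lambda>x. c * f x)"
  by (intro flat_algebra.mult flat_algebra.const)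

lemma flat_algebra_diff:
  assumes "flat_algebra f" "flat_algebra g"
  shows "flat_algebra (\<lambda>x. f x - g x)"
  using flat_algebra.add[OF assms(1) flat_algebra_cmult[OF assms(2), of "-1"]] by simp

lemma flat_algebra_affine: "flat_algebra f \<Longrightarrow> flat_algebra (\<lambda>x. f (s * x + t))"
proof (induction rule: flat_algebra.induct)
  case (flat i u v)
  have "(\<lambda>x. flat i (u * (s * x + t) + v)) = (\<lambda>x. flat i ((u * s) * x + (u * t + v)))"
    by (simp add: algebra_simps)
  then show ?case by (simp only: flat_algebra.flat)
qed (auto intro: flat_algebra.intros)

lemma flat_algebra_DERIV:
  "flat_algebra f \<Longrightarrow> \<exists>f'. flat_algebra f' \<and> (\<forall>x. (f has_real_derivative f' x) (at x))"
proof (induction rule: flat_algebra.induct)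
  case (flat i s t)
  have "flat_algebra (\<lambda>x. s * (flat (i + 2) (s * x + t) - real i * flat (i + 1) (s * x + t)))"
    by (intro flat_algebra_cmult flat_algebra_diff flat_algebra.flat)
  moreover have "((\<lambda>x. flat i (s * x + t)) has_real_derivative
       s * (flat (i + 2) (s * x + t) - real i * flat (i + 1) (s * x + t))) (at x)" for x
    by (rule DERIV_chain2[OF DERIV_flat, THEN DERIV_cong]) (auto intro!: derivative_eq_intros)
  ultimately show ?case by blast
next
  case (const c)
  have "\<forall>x. ((\<lambda>x. c) has_real_derivative 0) (at x)" by simp
  then show ?case using flat_algebra.const[of 0] by blast
next
  case (add f g)
  then obtain f' g' where "flat_algebra f'" "flat_algebra g'"
    "\<And>x. (f has_real_derivative f' x) (at x)" "\<And>x. (g has_real_derivative g' x) (at x)"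
    by blast
  then show ?case
    by (intro exI[of _ "\<lambda>x. f' x + g' x"]) (auto intro: flat_algebra.add DERIV_add)
next
  case (mult f g)
  then obtain f' g' where "flat_algebra f'" "flat_algebra g'"
    "\<And>x. (f has_real_derivative f' x) (at x)" "\<And>x. (g has_real_derivative g' x) (at x)"
    by blast
  with mult.hyps show ?case
    by (intro exI[of _ "\<lambda>x. f' x * g x + g' x * f x"])
       (auto intro!: flat_algebra.add DERIV_mult intro: flat_algebra.mult)
qed

lemma flat_algebra_deriv: "flat_algebra f \<Longrightarrow> flat_algebra (deriv f)"
  using flat_algebra_DERIV DERIV_imp_deriv by (metis ext)

lemma flat_algebra_has_deriv: "flat_algebra f \<Longrightarrow> (f has_real_derivative deriv f x) (at x)"
  using flat_algebra_DERIV DERIV_imp_deriv by metis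

lemma flat_algebra_continuous: "flat_algebra f \<Longrightarrow> continuous_on S f"
  using flat_algebra_has_deriv by (meson DERIV_isCont continuous_at_imp_continuous_on)

lemma flat_algebra_smooth:
  assumes "flat_algebra f" shows "(deriv ^^ n) f differentiable_on S"
proof -
  have "flat_algebra ((deriv ^^ n) f)"
    using assms by (induction n) (auto intro: flat_algebra_deriv)
  then show ?thesis
    by (meson flat_algebra_has_deriv differentiable_at_withinI differentiable_on_def
        real_differentiable_def)
qed

text \<open>\<open>F\<close> is the normalised antiderivative of the bump exp(-1/x) exp(-1/(1-x)) on
  (0,1). Only the derivative \<rho> is placed in \<open>flat_algebra\<close>, which suffices for the
  smoothness of \<open>F\<close>.\<close>

lemma smooth_step:
  obtains F \<rho> :: "real \<Rightarrow> real" where "flat_algebra \<rho>"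
    "\<And>x. (F has_real_derivative \<rho> x) (at x)" "\<And>x. 0 \<le> \<rho> x"
    "\<And>x. x \<le> 0 \<or> 1 \<le> x \<Longrightarrow> \<rho> x = 0"
    "\<And>x. x \<le> 0 \<Longrightarrow> F x = 0" "\<And>x. 1 \<le> x \<Longrightarrow> F x = 1"
proof -
  define r :: "real \<Rightarrow> real" where "r = (\<lambda>x. flat 0 (1 * x + 0) * flat 0 ((-1) * x + 1))"
  have r: "flat_algebra r"
    unfolding r_def by (intro flat_algebra.mult flat_algebra.flat)
  have "\<exists>F. \<forall>x::real. -\<infinity> < ereal x \<longrightarrow> ereal x < \<infinity> \<longrightarrow> (F has_vector_derivative r x) (at x)"
    by (rule einterval_antiderivative) (use flat_algebra_continuous[OF r, of UNIV] in \<open>auto simp: continuous_on_eq_continuous_at\<close>)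
  then obtain F0 where F0: "\<And>x. (F0 has_real_derivative r x) (at x)"
    by (auto simp: has_real_derivative_iff_has_vector_derivative)
  have r0: "0 \<le> r x" for x by (simp add: r_def flat_def)
  have rz: "r x = 0" if "x \<le> 0 \<or> 1 \<le> x" for x using that by (auto simp: r_def flat_def)
  have cont: "continuous_on S F0" for S
    using F0 by (meson DERIV_isCont continuous_at_imp_continuous_on)
  have lt: "F0 0 < F0 1"
    by (rule DERIV_pos_imp_increasing_open[OF _ _ cont])
       (use F0 in \<open>force simp: r_def flat_def\<close>)+
  have left: "F0 x = F0 0" if "x \<le> 0" for x
    using DERIV_isconst2[of x 0 F0 0] that F0 rz cont
    by (metis DERIV_isconst_end less_eq_real_def)
  have right: "F0 x = F0 1" if "1 \<le> x" for x
    using that F0 rz cont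
    by (metis DERIV_isconst_end less_eq_real_def)
  define D where "D = F0 1 - F0 0"
  have D: "D > 0" using lt by (simp add: D_def)
  show ?thesis
  proof (rule that[of "\<lambda>x. (1 / D) * r x" "\<lambda>x. (1 / D) * (F0 x - F0 0)"])
    show "((\<lambda>x. (1 / D) * (F0 x - F0 0)) has_real_derivative (1 / D) * r x) (at x)" for x
      by (rule DERIV_cmult) (auto intro!: derivative_eq_intros F0)
    show "(1 / D) * (F0 x - F0 0) = 1" if "1 \<le> x" for x
      using right[OF that] D by (simp add: D_def[symmetric])
    show "(1 / D) * (F0 x - F0 0) = 0" if "x \<le> 0" for x
      unfolding left[OF that] by simp
    show "flat_algebra (\<lambda>x. (1 / D) * r x)"
      by (rule flat_algebra_cmult[OF r])
  qed (use r0 rz D in auto)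
qed

subsection \<open>Bounded distributional second derivatives\<close>

lemma deriv01_eqI:
  assumes "(f has_real_derivative f') (at x within {0..1})" "x \<in> {0..1}"
  shows "deriv01 f x = f'"
  unfolding deriv01_def
  by (rule vector_derivative_within_closed_interval)
     (use assms in \<open>auto simp: has_real_derivative_iff_has_vector_derivative\<close>)

lemma differentiable_on_deriv01:
  assumes "f differentiable_on {0..1}" "x \<in> {0..1}"
  shows "(f has_real_derivative deriv01 f x) (at x within {0..1})"
proof -
  obtain f' where "(f has_real_derivative f') (at x within {0..1})"
    using assms unfolding differentiable_on_def real_differentiable_def by blast
  with deriv01_eqI[OF this assms(2)] show ?thesis by simp
qed

lemma weighted_mean_close:
  fixes u w :: "real \<Rightarrow> real"
  assumes u: "continuous_on {0..1} u" and w: "continuous_on {0..1} w"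
    and w0: "\<And>s. s \<in> {0..1} \<Longrightarrow> 0 \<le> w s" and one: "(w has_integral 1) {0..1}"
    and close: "\<And>s. s \<in> {0..1} \<Longrightarrow> w s \<noteq> 0 \<Longrightarrow> \<bar>u s - z\<bar> \<le> \<delta>"
  shows "\<bar>integral {0..1} (\<lambda>s. u s * w s) - z\<bar> \<le> \<delta>"
proof -
  have int: "(\<lambda>s. u s * w s) integrable_on {0..1}"
    by (intro integrable_continuous_real continuous_intros u w)
  have z: "((\<lambda>s. z * w s) has_integral z) {0..1}"
    using has_integral_mult_right[OF one, of z] by simp
  have d: "((\<lambda>s. \<delta> * w s) has_integral \<delta>) {0..1}"
    using has_integral_mult_right[OF one, of \<delta>] by simp
  have *: "((\<lambda>s. u s * w s - z * w s) has_integral (integral {0..1} (\<lambda>s. u s * w s) - z)) {0..1}"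
    by (intro has_integral_diff integrable_integral int z)
  have "norm (integral {0..1} (\<lambda>s. u s * w s - z * w s)) \<le> integral {0..1} (\<lambda>s. \<delta> * w s)"
  proof (rule Henstock_Kurzweil_Integration.integral_norm_bound_integral)
    fix s :: real assume s: "s \<in> {0..1}"
    have "norm (u s * w s - z * w s) = \<bar>u s - z\<bar> * w s"
      using w0[OF s] by (simp add: abs_mult flip: left_diff_distrib)
    also have "\<dots> \<le> \<delta> * w s"
      using close[OF s] w0[OF s] by (cases "w s = 0") (auto intro: mult_right_mono)
    finally show "norm (u s * w s - z * w s) \<le> \<delta> * w s" .
  qed (use * d in \<open>auto simp: integrable_on_def\<close>)
  then show ?thesis
    unfolding integral_unique[OF *] integral_unique[OF d] by simp
qed

text \<open>One integration by parts moves a derivative from the test function to \<open>H\<close>;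
  the boundary terms vanish with \<psi> at 0 and 1. The distributional identity thus becomes a
  statement about the genuine function \<open>deriv01 H\<close>.\<close>

lemma distr_deriv2_by_parts:
  assumes H: "H differentiable_on {0..1}" and u: "continuous_on {0..1} (deriv01 H)"
    and distr: "distr_deriv2_01 H g"
    and \<phi>: "\<phi> \<in> test_functions01" and \<psi>: "flat_algebra \<psi>" "\<And>x. (\<phi> has_real_derivative \<psi> x) (at x)"
    and ends: "\<psi> 0 = 0" "\<psi> 1 = 0"
  shows "(LINT x|lebesgue_on {0..1}. g x * \<phi> x) = - integral {0..1} (\<lambda>s. deriv01 H s * \<psi> s)"
proof -
  have d\<phi>: "deriv \<phi> = \<psi>" using \<psi>(2) by (auto intro!: ext DERIV_imp_deriv)
  have cH: "continuous_on {0..1} H" using H by (rule differentiable_imp_continuous_on)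
  have c: "continuous_on {0..1} \<psi>" "continuous_on {0..1} (deriv \<psi>)"
    using \<psi>(1) by (auto intro: flat_algebra_continuous flat_algebra_deriv)
  have int1: "(\<lambda>s. H s * deriv \<psi> s) integrable_on {0..1}"
    and int2: "(\<lambda>s. deriv01 H s * \<psi> s) integrable_on {0..1}"
    by (intro integrable_continuous_real continuous_intros cH c u)+
  have "((\<lambda>s. deriv01 H s * \<psi> s + deriv \<psi> s * H s) has_integral (H 1 * \<psi> 1 - H 0 * \<psi> 0)) {0..1}"
    by (rule fundamental_theorem_of_calculus)
       (auto simp: has_real_derivative_iff_has_vector_derivative[symmetric]
         intro!: DERIV_mult differentiable_on_deriv01 H
         intro: has_field_derivative_at_within flat_algebra_has_deriv[OF \<psi>(1)])
  then have "integral {0..1} (\<lambda>s. deriv01 H s * \<psi> s + H s * deriv \<psi> s) = 0"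
    using ends by (simp add: integral_unique mult.commute)
  then have "integral {0..1} (\<lambda>s. H s * deriv \<psi> s) = - integral {0..1} (\<lambda>s. deriv01 H s * \<psi> s)"
    using Henstock_Kurzweil_Integration.integral_add[OF int2 int1] by simp
  moreover have "(LINT x|lebesgue_on {0..1}. H x * deriv (deriv \<phi>) x) = integral {0..1} (\<lambda>s. H s * deriv \<psi> s)"
    unfolding d\<phi> by (intro lebesgue_integral_eq_integral continuous_imp_integrable_real continuous_intros cH c) auto
  ultimately show ?thesis
    using distr \<phi> by (simp add: distr_deriv2_01_def)
qed

text \<open>Hoelder's inequality, where the integral of \<phi> is at most the length of an interval
  containing its support.\<close>

lemma Linf_norm01_integral_bound:
  assumes k: "Linf_norm01 g = ennreal k" "0 \<le> k"
    and \<phi>: "continuous_on {0..1} \<phi>" "\<And>s. 0 \<le> \<phi> s" "\<And>s. \<phi> s \<le> 1"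
    and supp: "\<And>s. s < p \<or> q < s \<Longrightarrow> \<phi> s = 0" and pq: "0 \<le> p" "p \<le> q" "q \<le> 1"
  shows "\<bar>LINT x|lebesgue_on {0..1}. g x * \<phi> x\<bar> \<le> k * (q - p)"
proof -
  have AE: "AE x in lebesgue_on {0..1}. \<bar>g x\<bar> \<le> k"
    using esssup_AE[of "\<lambda>x. ennreal \<bar>g x\<bar>" "lebesgue_on {0..1}"] k
    by (simp add: Linf_norm01_def)
  have int: "integrable (lebesgue_on {0..1}) (\<lambda>x. k * \<phi> x)"
    by (intro continuous_imp_integrable_real continuous_intros \<phi>)
  \<comment> \<open>Integrability is asked of the dominating function alone: a non-integrable left
    side has integral 0, below the nonnegative right side.\<close>
  have "(LINT x|lebesgue_on {0..1}. norm (g x * \<phi> x)) \<le> (LINT x|lebesgue_on {0..1}. k * \<phi> x)"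
  proof (rule integral_mono_AE'[OF int])
    show "AE x in lebesgue_on {0..1}. norm (g x * \<phi> x) \<le> k * \<phi> x"
      using AE by (rule AE_mp) (auto simp: abs_mult \<phi> intro!: mult_right_mono AE_I2)
  qed (auto simp: \<phi> k)
  also have "\<dots> = k * integral {0..1} \<phi>"
    by (subst lebesgue_integral_eq_integral[OF int]) auto
  finally have le: "(LINT x|lebesgue_on {0..1}. norm (g x * \<phi> x)) \<le> k * integral {0..1} \<phi>" .
  have "integral {0..1} \<phi> = integral {p..q} \<phi>"
    by (rule integral_spike_set)
       (use supp pq in \<open>auto simp: not_le intro: negligible_subset[of "{}"]\<close>)
  also have "integral {p..q} \<phi> \<le> integral {p..q} (\<lambda>_. 1)"
    by (rule integral_le) (use \<phi> pq in \<open>auto intro!: integrable_continuous_real continuous_on_subset[OF \<phi>(1)]\<close>)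
  also have "\<dots> = q - p" using pq by simp
  finally have "k * integral {0..1} \<phi> \<le> k * (q - p)" using k(2) by (rule mult_left_mono)
  with le show ?thesis
    using integral_norm_bound[of "lebesgue_on {0..1}" "\<lambda>x. g x * \<phi> x"]
    unfolding real_norm_def by linarith
qed

text \<open>Testing against the difference of two smooth steps, at \<open>x\<close> and at \<open>y\<close>, compares
  the averages of \<open>H'\<close> near these points.\<close>

lemma deriv01_increment_bound_interior:
  assumes H: "C11_on01 H" and distr: "distr_deriv2_01 H g"
    and k: "Linf_norm01 g = ennreal k" "0 \<le> k" and xy: "0 < x" "x < y" "y < 1"
  shows "\<bar>deriv01 H y - deriv01 H x\<bar> \<le> k * (y - x)"
proof -
  define u where "u = deriv01 H"
  obtain L where L: "L-lipschitz_on {0..1} u" and Hd: "H differentiable_on {0..1}"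
    using H by (auto simp: C11_on01_def u_def)
  have L0: "0 \<le> L" using L by (rule lipschitz_on_nonneg)
  have u: "continuous_on {0..1} u" using L by (rule lipschitz_on_continuous_on)
  obtain F \<rho> :: "real \<Rightarrow> real" where \<rho>: "flat_algebra \<rho>"
    and F: "\<And>x. (F has_real_derivative \<rho> x) (at x)" and \<rho>0: "\<And>x. 0 \<le> \<rho> x"
    and \<rho>z: "\<And>x. x \<le> 0 \<or> 1 \<le> x \<Longrightarrow> \<rho> x = 0"
    and F0: "\<And>x. x \<le> 0 \<Longrightarrow> F x = 0" and F1: "\<And>x. 1 \<le> x \<Longrightarrow> F x = 1"
    using smooth_step by metis
  have Fmono: "F s \<le> F t" if "s \<le> t" for s t
    by (rule DERIV_nonneg_imp_nondecreasing[OF that]) (use F \<rho>0 in blast)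
  have F_bounds: "0 \<le> F s" "F s \<le> 1" for s
    using Fmono[of "min s 0" s] F0[of "min s 0"] Fmono[of s "max s 1"] F1[of "max s 1"] by auto
  \<comment> \<open>Here \<open>e\<close> is the width of the steps. The two averages cost
    \<open>L * e\<close> each, and the support [x, y + e] costs the extra \<open>k * e\<close>; the
    condition \<open>e < 1 - y\<close> keeps it inside (0,1).\<close>
  have step: "\<bar>u y - u x\<bar> \<le> k * (y - x) + (2 * L + k) * e" if e: "0 < e" "e < 1 - y" for e
  proof -
    \<comment> \<open>\<open>w z\<close> is a probability density on [z, z + e], and \<phi> rises
      from 0 to 1 after \<open>x\<close> and falls back after \<open>y\<close>, approximating the
      indicator of [x, y].\<close>
    define w where "w = (\<lambda>z s. (1 / e) * \<rho> ((1 / e) * s + (- z / e)))"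
    define \<phi> where "\<phi> = (\<lambda>s. F ((1 / e) * s + (- x / e)) - F ((1 / e) * s + (- y / e)))"
    have w: "flat_algebra (w z)" for z
      unfolding w_def by (intro flat_algebra_cmult flat_algebra_affine \<rho>)
    have Fw: "((\<lambda>s. F ((1 / e) * s + (- z / e))) has_real_derivative w z s) (at s)" for z s
      unfolding w_def by (rule DERIV_chain2[OF F, THEN DERIV_cong]) (use e in \<open>auto intro!: derivative_eq_intros\<close>)
    have w0: "0 \<le> w z s" for z s using \<rho>0 e by (simp add: w_def)
    have wz: "w z s = 0" if "s \<le> z \<or> z + e \<le> s" for z s
    proof -
      have "(1 / e) * s + (- z / e) \<le> 0 \<or> 1 \<le> (1 / e) * s + (- z / e)"
        using that e by (auto simp: field_simps)
      then show ?thesis using \<rho>z by (simp add: w_def)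
    qed
    have Fs0: "F ((1 / e) * s + (- z / e)) = 0" if "s \<le> z" for z s
      by (rule F0) (use that e in \<open>auto simp: field_simps\<close>)
    have Fs1: "F ((1 / e) * s + (- z / e)) = 1" if "z + e \<le> s" for z s
      by (rule F1) (use that e in \<open>auto simp: field_simps\<close>)
    have mean: "\<bar>integral {0..1} (\<lambda>s. u s * w z s) - u z\<bar> \<le> L * e" if z: "0 < z" "z + e < 1" for z
    proof (rule weighted_mean_close[OF u flat_algebra_continuous[OF w] w0])
      have "(w z has_integral (F ((1 / e) * 1 + (- z / e)) - F ((1 / e) * 0 + (- z / e)))) {0..1}"
        using has_field_derivative_at_within[OF Fw[of z]]
        by (intro fundamental_theorem_of_calculus)
           (simp_all add: has_real_derivative_iff_has_vector_derivative)
      then show "(w z has_integral 1) {0..1}"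
        using Fs0[of 0 z] Fs1[of z 1] z by simp
    next
      fix s assume s: "s \<in> {0..1}" "w z s \<noteq> 0"
      then have "z < s" "s < z + e" using wz[of s z] by (meson not_le)+
      moreover have "\<bar>u s - u z\<bar> \<le> L * \<bar>s - z\<bar>"
        using lipschitz_onD[OF L, of s z] s z e by (auto simp: dist_real_def)
      ultimately show "\<bar>u s - u z\<bar> \<le> L * e"
        using L0 mult_left_mono[of "\<bar>s - z\<bar>" e L] by simp
    qed
    define \<psi> where "\<psi> = (\<lambda>s. w x s - w y s)"
    have \<psi>: "flat_algebra \<psi>" unfolding \<psi>_def by (intro flat_algebra_diff w)
    have \<phi>\<psi>: "(\<phi> has_real_derivative \<psi> s) (at s)" for s
      unfolding \<phi>_def \<psi>_def by (intro DERIV_diff Fw)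
    have \<phi>_bounds: "0 \<le> \<phi> s" "\<phi> s \<le> 1" for s
    proof -
      have "(1 / e) * s + (- y / e) \<le> (1 / e) * s + (- x / e)"
        using xy e by (simp add: divide_right_mono)
      then show "0 \<le> \<phi> s" using Fmono unfolding \<phi>_def by force
      show "\<phi> s \<le> 1"
        using F_bounds(2)[of "(1 / e) * s + (- x / e)"] F_bounds(1)[of "(1 / e) * s + (- y / e)"]
        unfolding \<phi>_def by linarith
    qed
    have supp: "\<phi> s = 0" if "s < x \<or> y + e < s" for s
      unfolding \<phi>_def using that Fs0[of s x] Fs0[of s y] Fs1[of x s] Fs1[of y s] xy by auto
    have "deriv \<phi> = \<psi>" using \<phi>\<psi> by (auto intro!: ext DERIV_imp_deriv)
    have "(deriv ^^ n) \<phi> differentiable_on UNIV" for n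
    proof (cases n)
      case 0
      then show ?thesis
        using \<phi>\<psi> by (auto simp: differentiable_on_def real_differentiable_def)
    next
      case (Suc m)
      then show ?thesis
        using flat_algebra_smooth[OF \<psi>, of m] \<open>deriv \<phi> = \<psi>\<close> by (simp add: funpow_swap1)
    qed
    moreover have "closure {s. \<phi> s \<noteq> 0} \<subseteq> {x..y + e}"
      by (rule closure_minimal) (use supp in \<open>force+\<close>)
    ultimately have test: "\<phi> \<in> test_functions01"
      unfolding test_functions01_def using xy e by force
    have "(LINT s|lebesgue_on {0..1}. g s * \<phi> s) = - integral {0..1} (\<lambda>s. u s * \<psi> s)"
      unfolding u_def
      by (rule distr_deriv2_by_parts[OF Hd u[unfolded u_def] distr test \<psi> \<phi>\<psi>])
         (use xy e wz in \<open>auto simp: \<psi>_def\<close>)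
    moreover have "integral {0..1} (\<lambda>s. u s * \<psi> s)
        = integral {0..1} (\<lambda>s. u s * w x s) - integral {0..1} (\<lambda>s. u s * w y s)"
      unfolding \<psi>_def right_diff_distrib
      by (intro Henstock_Kurzweil_Integration.integral_diff integrable_continuous_real
          continuous_intros u flat_algebra_continuous w)
    moreover have "\<bar>LINT s|lebesgue_on {0..1}. g s * \<phi> s\<bar> \<le> k * (y + e - x)"
    proof (rule Linf_norm01_integral_bound[OF k _ \<phi>_bounds supp])
      show "continuous_on {0..1} \<phi>"
        using \<phi>\<psi> by (meson DERIV_isCont continuous_at_imp_continuous_on)
    qed (use xy e in auto)
    ultimately show ?thesis
      using mean[of x] mean[of y] xy e by (simp add: algebra_simps)
  qed
  \<comment> \<open>Letting \<open>e\<close> tend to 0 removes the a priori Lipschitz constant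
    \<open>L\<close> and leaves \<open>k\<close>.\<close>
  have "((\<lambda>e. k * (y - x) + (2 * L + k) * e) \<longlongrightarrow> k * (y - x) + (2 * L + k) * 0) (at_right 0)"
    by (intro tendsto_intros)
  moreover have "\<forall>\<^sub>F e in at_right 0. \<bar>u y - u x\<bar> \<le> k * (y - x) + (2 * L + k) * e"
    by (rule eventually_at_rightI[of 0 "1 - y"]) (use step xy in auto)
  ultimately have "\<bar>u y - u x\<bar> \<le> k * (y - x) + (2 * L + k) * 0"
    using tendsto_lowerbound trivial_limit_at_right_real by blast
  then show ?thesis by (simp add: u_def)
qed

text \<open>\<open>deriv01 H\<close> is continuous on the closed interval, so the interior Lipschitz
  bound passes to the closure.\<close>

lemma deriv01_increment_bound:
  assumes H: "C11_on01 H" and distr: "distr_deriv2_01 H g"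
    and k: "Linf_norm01 g = ennreal k" "0 \<le> k" and xy: "x \<in> {0..1}" "y \<in> {0..1}"
  shows "\<bar>deriv01 H y - deriv01 H x\<bar> \<le> k * \<bar>y - x\<bar>"
proof -
  obtain L where L: "L-lipschitz_on {0..1} (deriv01 H)"
    using H by (auto simp: C11_on01_def)
  have c: "continuous_on {0..1} (deriv01 H)" using L by (rule lipschitz_on_continuous_on)
  have "k-lipschitz_on {0<..<1} (deriv01 H)"
  proof (rule lipschitz_onI)
    fix s t :: real assume "s \<in> {0<..<1}" "t \<in> {0<..<1}"
    then show "dist (deriv01 H s) (deriv01 H t) \<le> k * dist s t"
      using deriv01_increment_bound_interior[OF H distr k, of s t]
        deriv01_increment_bound_interior[OF H distr k, of t s]
      by (cases s t rule: linorder_cases) (auto simp: dist_real_def abs_minus_commute)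
  qed (rule k)
  then have "k-lipschitz_on (closure {0<..<1}) (deriv01 H)"
    by (rule lipschitz_on_closure) (use c in simp)
  then show ?thesis
    using lipschitz_onD[of k _ "deriv01 H" y x] xy by (simp add: dist_real_def)
qed

subsection \<open>The lower bound for the infimum\<close>

lemma deriv01_interior:
  assumes "f differentiable_on {0..1}" "0 < x" "x < 1"
  shows "(f has_real_derivative deriv01 f x) (at x)"
  using differentiable_on_deriv01[OF assms(1), of x] assms
  by (simp add: at_within_Icc_at)

text \<open>Taylor's bound from a Lipschitz derivative. Running along the segment from
  \<open>x\<close> to \<open>y\<close> with parameter \<open>t\<close> treats both orders of the
  points at once, which is needed for expansions from 0 and from 1.\<close>

lemma first_order_remainder_bound:
  assumes H: "H differentiable_on {0..1}"
    and lip: "\<And>s t. s \<in> {0..1} \<Longrightarrow> t \<in> {0..1} \<Longrightarrow> \<bar>deriv01 H t - deriv01 H s\<bar> \<le> k * \<bar>t - s\<bar>"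
    and x: "x \<in> {0..1}" and y: "y \<in> {0..1}"
  shows "\<bar>H y - H x - deriv01 H x * (y - x)\<bar> \<le> k * (y - x)\<^sup>2 / 2"
proof (cases "x = y")
  case False
  define d where "d = y - x"
  have seg: "x + t * d \<in> {0..1}" if "t \<in> {0..1}" for t
  proof -
    have "x + t * d = (1 - t) * x + t * y" by (simp add: d_def algebra_simps)
    then show ?thesis using x y that by (auto intro!: convex_bound_le)
  qed
  have inner: "0 < x + t * d" "x + t * d < 1" if "0 < t" "t < 1" for t
  proof -
    consider "0 < d" | "d < 0" using False unfolding d_def by linarith
    then have "0 < x + t * d \<and> x + t * d < 1"
    proof cases
      case 1
      then have "0 < t * d" "t * d < 1 * d" using that by (auto intro!: mult_strict_right_mono)
      then show ?thesis using x y by (auto simp: d_def)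
    next
      case 2
      then have "t * d < 0" "1 * d < t * d"
        using that by (auto intro!: mult_strict_right_mono_neg mult_pos_neg)
      then show ?thesis using x y by (auto simp: d_def)
    qed
    then show "0 < x + t * d" "x + t * d < 1" by blast+
  qed
  have "s * (H y - H x - deriv01 H x * d) \<le> k * d\<^sup>2 / 2" if s: "s = 1 \<or> s = -1" for s :: real
  proof -
    \<comment> \<open>\<open>D\<close> is nondecreasing because \<open>s\<close> times the change of
      slope is at most \<open>k * d\<^sup>2 * t\<close>; comparing \<open>D 0\<close> with
      \<open>D 1\<close> gives one side of the bound for each sign \<open>s\<close>.\<close>
    define D where "D = (\<lambda>t. k * d\<^sup>2 * (t\<^sup>2 / 2) - s * (H (x + t * d) - deriv01 H x * d * t))"
    have "D 0 \<le> D 1"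
    proof (rule DERIV_nonneg_imp_increasing_open[of 0 1 D])
      fix t :: real assume t: "0 < t" "t < 1"
      define D' where "D' = k * d\<^sup>2 * t - s * (deriv01 H (x + t * d) * d - deriv01 H x * d)"
      have "((\<lambda>t. H (x + t * d)) has_real_derivative deriv01 H (x + t * d) * d) (at t)"
        by (rule DERIV_chain2[where f = H and g = "\<lambda>t. x + t * d"], rule deriv01_interior[OF H inner[OF t]])
           (rule derivative_eq_intros refl | simp)+
      then have "(D has_real_derivative D') (at t)"
        unfolding D_def D'_def by (auto intro!: derivative_eq_intros)
      moreover have "s * (deriv01 H (x + t * d) * d - deriv01 H x * d) \<le> k * d\<^sup>2 * t"
      proof -
        have "s * (deriv01 H (x + t * d) * d - deriv01 H x * d)
            \<le> \<bar>s * (deriv01 H (x + t * d) * d - deriv01 H x * d)\<bar>" by (rule abs_ge_self)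
        also have "\<dots> = \<bar>deriv01 H (x + t * d) - deriv01 H x\<bar> * \<bar>d\<bar>"
          unfolding left_diff_distrib[symmetric] abs_mult using s by auto
        also have "\<dots> \<le> k * \<bar>x + t * d - x\<bar> * \<bar>d\<bar>"
          by (intro mult_right_mono lip x seg) (use t in auto)
        also have "\<dots> = k * d\<^sup>2 * t"
          using t by (simp add: abs_mult power2_eq_square)
        finally show ?thesis .
      qed
      ultimately show "\<exists>l. (D has_real_derivative l) (at t) \<and> 0 \<le> l"
        by (intro exI[of _ D']) (simp add: D'_def)
    next
      have "continuous_on {0..1} (\<lambda>t. H (x + t * d))"
      proof (rule continuous_on_compose2[OF differentiable_imp_continuous_on[OF H]])
        show "continuous_on {0..1} (\<lambda>t. x + t * d)" by (intro continuous_intros)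
        show "(\<lambda>t. x + t * d) ` {0..1} \<subseteq> {0..1}" using seg by blast
      qed
      then show "continuous_on {0..1} D"
        unfolding D_def by (intro continuous_intros) simp_all
    qed simp
    moreover have "x + d = y" by (simp add: d_def)
    ultimately show ?thesis by (simp add: D_def algebra_simps)
  qed
  from this[OF disjI1[OF refl]] this[OF disjI2[OF refl]] show ?thesis
    unfolding d_def[symmetric] mult_1_left mult_minus1 by (rule abs_leI)
qed simp

text \<open>The parameters satisfy a p + b q - c = \<sigma> M (p^2 + q^2) / 2, while Taylor
  expansion from both ends bounds \<sigma> times the left side by k (p^2 + q^2) / 2 for every
  competitor.\<close>

lemma Mstar_lower_bound:
  fixes \<sigma> M m p q :: real
  assumes \<sigma>: "\<sigma> = 1 \<or> \<sigma> = -1"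
    and p: "0 \<le> p" and q: "0 \<le> q" and pq: "p + q \<le> 1" "0 < p + q"
    and gap: "p + q = 1 \<or> \<sigma> = 1 \<and> m = 0"
    and a: "a = m + \<sigma> * M * p" and b: "b = m + \<sigma> * M * q"
    and c: "c = m + \<sigma> * M * (p\<^sup>2 + q\<^sup>2) / 2"
  shows "ennreal M \<le> Mstar a b c"
  unfolding Mstar_def
proof (rule Inf_greatest)
  fix z assume "z \<in> {Linf_norm01 g | H g.
     C11_on01 H \<and> distr_deriv2_01 H g \<and> H 0 = 0 \<and> H 1 = c \<and>
     deriv01 H 0 = a \<and> deriv01 H 1 = b \<and> (\<forall>x\<in>{0..1}. 0 \<le> deriv01 H x)}"
  then obtain H g where z: "z = Linf_norm01 g" and H: "C11_on01 H" and distr: "distr_deriv2_01 H g"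
    and ends: "H 0 = 0" "H 1 = c" "deriv01 H 0 = a" "deriv01 H 1 = b"
    and mono: "\<forall>x\<in>{0..1}. 0 \<le> deriv01 H x"
    by blast
  show "ennreal M \<le> z"
  proof (cases "Linf_norm01 g")
    case (real k)
    have Hd: "H differentiable_on {0..1}" using H by (simp add: C11_on01_def)
    note remainder = first_order_remainder_bound[OF Hd deriv01_increment_bound[OF H distr real(2,1)]]
    have left: "\<bar>H p - a * p\<bar> \<le> k * p\<^sup>2 / 2"
      using remainder[of 0 p] p q pq by (simp add: ends)
    have right: "\<bar>H (1 - q) - (c - b * q)\<bar> \<le> k * q\<^sup>2 / 2"
      using remainder[of 1 "1 - q"] p q pq by (simp add: ends algebra_simps)
    have middle: "H p \<le> H (1 - q)"
    proof (rule DERIV_nonneg_imp_increasing_open[of p "1 - q" H])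
      show "continuous_on {p..1 - q} H"
        by (rule continuous_on_subset[OF differentiable_imp_continuous_on[OF Hd]]) (use p q in auto)
      show "\<exists>y. (H has_real_derivative y) (at x) \<and> 0 \<le> y" if "p < x" "x < 1 - q" for x
        using deriv01_interior[OF Hd, of x] mono that p q by (intro exI[of _ "deriv01 H x"]) auto
    qed (use pq in simp)
    have S: "0 < p\<^sup>2 + q\<^sup>2" using p q pq(2) by (auto simp: sum_power2_gt_zero_iff)
    have mpq: "m * (p + q) = m" using gap by auto
    have ab: "a * p + b * q = m + \<sigma> * (M * (p\<^sup>2 + q\<^sup>2))"
      unfolding a b using mpq by (simp add: power2_eq_square algebra_simps)
    have c': "2 * c = 2 * m + \<sigma> * (M * (p\<^sup>2 + q\<^sup>2))" unfolding c by simp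
    have gen: "2 * v - w \<le> 2 * u \<and> 2 * u \<le> 2 * v + w" if "\<bar>u - v\<bar> \<le> w / 2" for u v w :: real
      using that by linarith
    have bounds: "2 * (a * p) - k * p\<^sup>2 \<le> 2 * H p" "2 * H p \<le> 2 * (a * p) + k * p\<^sup>2"
      "2 * c - 2 * (b * q) - k * q\<^sup>2 \<le> 2 * H (1 - q)" "2 * H (1 - q) \<le> 2 * c - 2 * (b * q) + k * q\<^sup>2"
      using gen[OF left] gen[OF right] by auto
    have "M * (p\<^sup>2 + q\<^sup>2) \<le> k * p\<^sup>2 + k * q\<^sup>2"
    \<comment> \<open>For \<sigma> = 1, monotonicity bridges the possible gap between
      \<open>p\<close> and \<open>1 - q\<close>. For \<sigma> = -1 the opposite Taylor bounds are
      used, and there is no gap: both points coincide.\<close>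
    proof (cases "\<sigma> = 1")
      case True
      then show ?thesis
        using bounds middle ab c' unfolding True mult_1_left by linarith
    next
      case False
      then have s: "\<sigma> = -1" and "1 - q = p" using \<sigma> gap by auto
      then have "H (1 - q) = H p" by simp
      then show ?thesis
        using bounds ab c' unfolding s mult_minus1 by linarith
    qed
    then have "M * (p\<^sup>2 + q\<^sup>2) \<le> k * (p\<^sup>2 + q\<^sup>2)" by (simp add: distrib_left)
    then have "M \<le> k" using S by simp
    then show ?thesis using real z by (simp add: ennreal_leI)
  qed (simp add: z)
qed

subsection \<open>A twice continuously differentiable competitor\<close>

lemma continuous_pos_powr:
  assumes "0 < (r::real)" "continuous_on S f"
  shows "continuous_on S (\<lambda>x. max 0 (f x) powr r)"
  by (intro continuous_on_powr' continuous_intros assms) (use assms in auto)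

lemma DERIV_pos_powr:
  fixes r :: real
  assumes "1 < r"
  shows "((\<lambda>y. max 0 y powr r) has_real_derivative r * max 0 y powr (r - 1)) (at y)"
proof -
  consider "y = 0" | "y < 0" | "y > 0" by linarith
  then show ?thesis
  proof cases
    case 1
    \<comment> \<open>The difference quotient at 0 is the truncated power with exponent lowered by
      one, continuous since \<open>r > 1\<close>.\<close>
    have eq: "max 0 h powr (r - 1) = (max 0 (0 + h) powr r - max 0 0 powr r) / h" if "h \<noteq> 0" for h :: real
      using that by (auto simp: max_def powr_diff)
    have "continuous_on UNIV (\<lambda>h. max 0 h powr (r - 1))"
      using assms by (intro continuous_pos_powr) auto
    then have "((\<lambda>h. max 0 h powr (r - 1)) \<longlongrightarrow> max 0 0 powr (r - 1)) (at 0)"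
      unfolding continuous_on_def by blast
    then have "((\<lambda>h. (max 0 (0 + h) powr r - max 0 0 powr r) / h) \<longlongrightarrow> 0) (at 0)"
      by (auto intro: Lim_transform_eventually simp: eq eventually_at_filter)
    then show ?thesis using 1 by (simp add: DERIV_def)
  next
    case 2
    have "((\<lambda>y. 0) has_real_derivative 0) (at y)" by simp
    then have "((\<lambda>y. max 0 y powr r) has_real_derivative 0) (at y)"
      by (rule has_field_derivative_transform_within_open[where S="{..<0}"]) (use 2 in auto)
    then show ?thesis using 2 by simp
  next
    case 3
    have "((\<lambda>y. y powr r) has_real_derivative r * y powr (r - 1)) (at y)"
      using 3 by (rule has_real_derivative_powr)
    then have "((\<lambda>y. max 0 y powr r) has_real_derivative r * y powr (r - 1)) (at y)"
      by (rule has_field_derivative_transform_within_open[where S="{0<..}"]) (use 3 in auto)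
    then show ?thesis using 3 by simp
  qed
qed

text \<open>The extremal slope \<open>H'\<close> equals \<open>m\<close> except on intervals of lengths \<open>p\<close> and \<open>q\<close> at the
  two ends, where it is affine with slope \<open>\<plusminus>M\<close>. Replacing each factor \<open>1 - x / p\<close> by
  its power with exponent \<open>6/5\<close> makes the slope \<open>C\<^sup>1\<close>, costs a factor \<open>6/5\<close> in the second
  derivative and overshoots the integral \<open>c\<close>; averaging with the affine slope from \<open>a\<close> to \<open>b\<close>,
  which errs in the opposite direction, restores the integral. For \<open>p = 0\<close> the terms
  containing \<open>x / p\<close> carry a factor \<open>p\<close> and vanish.\<close>

lemma C2_competitor:
  fixes \<sigma> M m p q :: real
  assumes \<sigma>: "\<sigma> = 1 \<or> \<sigma> = -1" and M: "0 \<le> M" and m: "0 \<le> m"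
    and p: "0 \<le> p" and q: "0 \<le> q" and pq: "p + q \<le> 1" and gap: "p + q = 1 \<or> \<sigma> = 1 \<and> m = 0"
    and a: "a = m + \<sigma> * M * p" "0 \<le> a" and b: "b = m + \<sigma> * M * q" "0 \<le> b"
    and c: "c = m + \<sigma> * M * (p\<^sup>2 + q\<^sup>2) / 2"
  shows "\<exists>G U V. (\<forall>x. (G has_real_derivative U x) (at x)) \<and> (\<forall>x. (U has_real_derivative V x) (at x)) \<and>
    continuous_on UNIV V \<and> G 0 = 0 \<and> G 1 = c \<and> U 0 = a \<and> U 1 = b \<and>
    (\<forall>x\<in>{0..1}. 0 \<le> U x \<and> \<bar>V x\<bar> \<le> 6/5 * M)"
proof -
  define T :: "real \<Rightarrow> real \<Rightarrow> real" where "T = (\<lambda>r y. max 0 y powr r)"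
  \<comment> \<open>The exponents 11/5, 6/5 and 1/5 belong to \<open>G1\<close>, its slope and its
    second derivative; 5/11 comes from integrating the power 6/5. In \<open>V1\<close> the quotients
    \<open>p / p\<close> and \<open>q / q\<close> are 1, or 0 when the width is 0, which deletes the
    degenerate term.\<close>
  define G1 where "G1 = (\<lambda>x. m * x + \<sigma> * M * (p\<^sup>2 * (5/11) * (1 - T (11/5) (1 - x / p))
      + q\<^sup>2 * (5/11) * T (11/5) (1 - (1 - x) / q)))"
  define U1 where "U1 = (\<lambda>x. m + \<sigma> * M * (p * T (6/5) (1 - x / p) + q * T (6/5) (1 - (1 - x) / q)))"
  define V1 where "V1 = (\<lambda>x. \<sigma> * M * (6/5) * (q / q * T (1/5) (1 - (1 - x) / q) - p / p * T (1/5) (1 - x / p)))"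
  have T: "0 \<le> T r y" "y \<le> 1 \<Longrightarrow> 0 \<le> r \<Longrightarrow> T r y \<le> 1" for r y
    by (auto simp: T_def intro!: powr_le1)
  have T0: "T r y = 0" if "y \<le> 0" for r y using that by (simp add: T_def)
  have T1: "T r 1 = 1" for r by (simp add: T_def)
  have DT: "(T (11/5) has_real_derivative 11/5 * T (6/5) y) (at y)"
    "(T (6/5) has_real_derivative 6/5 * T (1/5) y) (at y)" for y
    unfolding T_def using DERIV_pos_powr[of "11/5" y] DERIV_pos_powr[of "6/5" y] by simp_all
  have dp: "((\<lambda>x. 1 - x / p) has_real_derivative - (1 / p)) (at x)"
    and dq: "((\<lambda>x. 1 - (1 - x) / q) has_real_derivative 1 / q) (at x)" for x
    by (rule DERIV_cong[OF DERIV_diff[OF DERIV_const DERIV_cdivide[OF DERIV_ident]]]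
        DERIV_cong[OF DERIV_diff[OF DERIV_const DERIV_cdivide[OF DERIV_diff[OF DERIV_const DERIV_ident]]]], simp)+
  note DTp = DERIV_chain2[OF DT(1) dp] DERIV_chain2[OF DT(2) dp]
  note DTq = DERIV_chain2[OF DT(1) dq] DERIV_chain2[OF DT(2) dq]
  have G1: "(G1 has_real_derivative U1 x) (at x)" for x
  proof -
    have "(G1 has_real_derivative m * 1 + \<sigma> * M * (p\<^sup>2 * (5/11) * (0 - 11/5 * T (6/5) (1 - x / p) * - (1 / p))
        + q\<^sup>2 * (5/11) * (11/5 * T (6/5) (1 - (1 - x) / q) * (1 / q)))) (at x)"
      unfolding G1_def by (intro DERIV_add DERIV_cmult DERIV_diff DERIV_const DERIV_ident DTp DTq)
    then show ?thesis
      by (cases "p = 0"; cases "q = 0"; simp add: U1_def power2_eq_square)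
  qed
  have U1: "(U1 has_real_derivative V1 x) (at x)" for x
  proof -
    have "(U1 has_real_derivative 0 + \<sigma> * M * (p * (6/5 * T (1/5) (1 - x / p) * - (1 / p))
        + q * (6/5 * T (1/5) (1 - (1 - x) / q) * (1 / q)))) (at x)"
      unfolding U1_def by (intro DERIV_add DERIV_cmult DERIV_const DTp DTq)
    moreover have "0 + \<sigma> * M * (p * (6/5 * T (1/5) (1 - x / p) * - (1 / p))
        + q * (6/5 * T (1/5) (1 - (1 - x) / q) * (1 / q))) = V1 x"
      unfolding V1_def by (cases "p = 0"; cases "q = 0"; simp add: algebra_simps)
    ultimately show ?thesis by simp
  qed
  have contT: "continuous_on UNIV (\<lambda>x. T (1/5) (f x))" if "continuous_on UNIV f" for f
    unfolding T_def by (rule continuous_pos_powr[OF _ that]) simp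
  have "continuous_on UNIV (\<lambda>x. T (1/5) (1 - x / p))" "continuous_on UNIV (\<lambda>x. T (1/5) (1 - (1 - x) / q))"
    using DERIV_isCont[OF dp] DERIV_isCont[OF dq]
    by (intro contT continuous_at_imp_continuous_on ballI; simp)+
  then have V1: "continuous_on UNIV V1"
    unfolding V1_def by (intro continuous_on_mult continuous_on_diff continuous_on_const)
  \<comment> \<open>Neither end profile reaches the other end: a positive width is at most 1, so the
    base is at most 0, and a zero width kills the product.\<close>
  have end_p: "p * T r (1 - 1 / p) = 0" and end_q: "q * T r (1 - 1 / q) = 0" for r
    using p q pq by (auto simp: T0 divide_simps)
  have U1_ends: "U1 0 = a" "U1 1 = b"
    using end_p end_q by (auto simp: U1_def a b T1)
  have G1_ends: "G1 0 = 0" "G1 1 = m + \<sigma> * M * (5/11) * (p\<^sup>2 + q\<^sup>2)"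
    using end_p[of "11/5"] end_q[of "11/5"] by (auto simp: G1_def T1 power2_eq_square algebra_simps)
  have U1_nonneg: "0 \<le> U1 x" if x: "x \<in> {0..1}" for x
  proof -
    define P Q where "P = T (6/5) (1 - x / p)" and "Q = T (6/5) (1 - (1 - x) / q)"
    have P: "0 \<le> P" "P \<le> 1" and Q: "0 \<le> Q" "Q \<le> 1"
      unfolding P_def Q_def using x p q by (auto intro!: T)
    show ?thesis
    proof (cases "\<sigma> = 1")
      case True
      then show ?thesis using m M p q P Q by (simp add: U1_def flip: P_def Q_def)
    next
      case False
      then have s: "\<sigma> = -1" using \<sigma> by simp
      \<comment> \<open>With \<sigma> = -1 the widths fill [0,1] without overlap, so at most one
        term is subtracted from \<open>m\<close>, and the slope stays above \<open>a\<close> or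
        above \<open>b\<close>.\<close>
      have "p * P = 0 \<or> q * Q = 0"
      proof (cases "p \<le> x")
        case True
        then show ?thesis using p by (auto simp: P_def intro!: T0)
      next
        case False
        then have "q \<le> 1 - x" using gap s by simp
        then show ?thesis using q by (auto simp: Q_def intro!: T0)
      qed
      moreover have "M * (p * P) \<le> M * p" "M * (q * Q) \<le> M * q"
        using P Q p q M by (auto intro!: mult_left_mono mult_left_le)
      ultimately show ?thesis
        using a b m by (auto simp: U1_def s algebra_simps simp flip: P_def Q_def)
    qed
  qed
  have V1_bound: "\<bar>V1 x\<bar> \<le> 6/5 * M" if x: "x \<in> {0..1}" for x
  proof -
    define P Q where "P = p / p * T (1/5) (1 - x / p)" and "Q = q / q * T (1/5) (1 - (1 - x) / q)"
    have "0 \<le> P" "P \<le> 1" "0 \<le> Q" "Q \<le> 1"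
      unfolding P_def Q_def using x p q by (auto intro!: T)
    then have "\<bar>Q - P\<bar> \<le> 1" by linarith
    then have "M * (6/5) * \<bar>Q - P\<bar> \<le> M * (6/5) * 1"
      by (rule mult_left_mono) (use M in simp)
    then show ?thesis
      using \<sigma> M unfolding V1_def P_def[symmetric] Q_def[symmetric] by (auto simp: abs_mult)
  qed
  \<comment> \<open>The errors at 1: \<open>G1 1\<close> is c - \<sigma> A, and the affine slope has
    integral (a + b) / 2 = c + \<sigma> B. Since \<open>A\<close> and \<open>B\<close> are
    nonnegative, a convex weight \<open>l\<close> cancels them.\<close>
  define A where "A = M * (p\<^sup>2 + q\<^sup>2) / 22"
  define B where "B = M * (p * (1 - p) + q * (1 - q)) / 2"
  have AB: "0 \<le> A" "0 \<le> B" using M p q pq by (auto simp: A_def B_def)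
  obtain l where l: "0 \<le> l" "l \<le> 1" "l * A = (1 - l) * B"
  proof (cases "A + B = 0")
    case True
    then show ?thesis using AB that[of 0] by simp
  next
    case False
    then show ?thesis
      using AB by (intro that[of "B / (A + B)"]) (auto simp: field_simps)
  qed
  define G where "G = (\<lambda>x. l * G1 x + (1 - l) * (a * x + (b - a) * x\<^sup>2 / 2))"
  define U where "U = (\<lambda>x. l * U1 x + (1 - l) * (a + (b - a) * x))"
  define V where "V = (\<lambda>x. l * V1 x + (1 - l) * (b - a))"
  have "(G has_real_derivative U x) (at x)" for x
    unfolding G_def U_def by (auto intro!: derivative_eq_intros G1 simp: field_simps)
  moreover have "(U has_real_derivative V x) (at x)" for x
    unfolding U_def V_def by (auto intro!: derivative_eq_intros U1)
  moreover have "continuous_on UNIV V"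
    unfolding V_def by (intro continuous_intros V1)
  moreover have "G 0 = 0" "U 0 = a" "U 1 = b"
    by (auto simp: G_def U_def G1_ends U1_ends algebra_simps)
  moreover have "G 1 = c"
  proof -
    have "G 1 = l * (c - \<sigma> * A) + (1 - l) * (c + \<sigma> * B)"
      unfolding G_def G1_ends a b c A_def B_def by (simp add: power2_eq_square field_simps)
    also have "\<dots> = c - \<sigma> * (l * A - (1 - l) * B)" by (simp add: algebra_simps)
    finally show ?thesis using l by simp
  qed
  moreover have "0 \<le> U x" if x: "x \<in> {0..1}" for x
  proof -
    have "a + (b - a) * x = (1 - x) * a + x * b" by (simp add: algebra_simps)
    then have "0 \<le> a + (b - a) * x" using x a b by simp
    then show ?thesis using U1_nonneg[OF x] l by (simp add: U_def)
  qed
  moreover have "\<bar>V x\<bar> \<le> 6/5 * M" if x: "x \<in> {0..1}" for x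
  proof -
    have "\<bar>q - p\<bar> \<le> 1" using p q pq by linarith
    then have "M * \<bar>q - p\<bar> \<le> M" using M by (rule mult_left_le)
    moreover have "\<bar>b - a\<bar> = M * \<bar>q - p\<bar>"
      using \<sigma> M by (auto simp: a b abs_mult simp flip: right_diff_distrib)
    ultimately have "\<bar>b - a\<bar> \<le> 6/5 * M" using M by linarith
    then have "l * \<bar>V1 x\<bar> + (1 - l) * \<bar>b - a\<bar> \<le> l * (6/5 * M) + (1 - l) * (6/5 * M)"
      by (intro add_mono mult_left_mono V1_bound x) (use l in auto)
    moreover have "\<bar>V x\<bar> \<le> l * \<bar>V1 x\<bar> + (1 - l) * \<bar>b - a\<bar>"
      using abs_triangle_ineq[of "l * V1 x" "(1 - l) * (b - a)"] l by (simp add: V_def abs_mult)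
    moreover have "l * (6/5 * M) + (1 - l) * (6/5 * M) = 6/5 * M" by (simp add: field_simps)
    ultimately show ?thesis by linarith
  qed
  ultimately show ?thesis by (intro exI[of _ G] exI[of _ U] exI[of _ V]) blast
qed

text \<open>The widths \<open>p\<close> and \<open>q\<close>, the bound \<open>M\<close> and the intermediate slope \<open>m\<close> of the
  extremal function. It is \<open>m = 0\<close> precisely in the first case of the formula for
  \<open>\<M>\<^sup>*\<close>; the sign \<open>\<sigma>\<close> is that of \<open>(a + b) / 2 - c\<close>.\<close>

lemma extremal_parameters:
  fixes a b c :: real
  assumes a: "0 \<le> a" and b: "0 \<le> b" and c: "0 < c"
  obtains \<sigma> M m p q where "\<sigma> = 1 \<or> \<sigma> = -1" "0 \<le> M" "0 \<le> m"
    "0 \<le> p" "0 \<le> q" "p + q \<le> 1" "0 < p + q" "p + q = 1 \<or> \<sigma> = 1 \<and> m = 0"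
    "a = m + \<sigma> * M * p" "b = m + \<sigma> * M * q" "c = m + \<sigma> * M * (p\<^sup>2 + q\<^sup>2) / 2"
\<comment> \<open>The first case is that of a slope reaching 0. Requiring \<open>0 < a + b\<close>
  sends a = b = 0, where both widths would be 0, to the second case.\<close>
proof (cases "0 < a + b \<and> 2 * c * (a + b) \<le> a\<^sup>2 + b\<^sup>2")
  case True
  then have n: "0 < a\<^sup>2 + b\<^sup>2" using c by (smt (verit) mult_pos_pos)
  \<comment> \<open>With \<open>m = 0\<close> the end slopes fall to 0 over the lengths a / M and b
    / M, and the integral (a^2 + b^2) / (2 M) must equal \<open>c\<close>.\<close>
  define M where "M = (a\<^sup>2 + b\<^sup>2) / (2 * c)"
  have M: "0 < M" using n c by (simp add: M_def)
  have sq: "a\<^sup>2 + b\<^sup>2 = 2 * c * M" using c by (simp add: M_def)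
  have ab: "a + b \<le> M" using True c by (simp add: M_def field_simps)
  have "M * ((a / M)\<^sup>2 + (b / M)\<^sup>2) / 2 = c"
  proof -
    have "M * ((a / M)\<^sup>2 + (b / M)\<^sup>2) / 2 = (a\<^sup>2 + b\<^sup>2) / (2 * M)"
      using M by (simp add: power_divide power2_eq_square flip: add_divide_distrib)
    also have "\<dots> = c" using M by (simp add: sq)
    finally show ?thesis .
  qed
  moreover have "a / M + b / M \<le> 1" "0 < a / M + b / M"
    using M ab True by (simp_all flip: add_divide_distrib)
  ultimately show ?thesis
    using M a b by (intro that[of 1 M 0 "a / M" "b / M"]) auto
next
  case False
  then have conv: "a\<^sup>2 + b\<^sup>2 \<le> 2 * c * (a + b)"
    using a b add_nonneg_eq_0_iff[OF a b] by auto
  define \<sigma> :: real where "\<sigma> = (if 2 * c \<le> a + b then 1 else -1)"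
  have \<sigma>: "\<sigma> = 1 \<or> \<sigma> = -1" by (simp add: \<sigma>_def)
  define e where "e = \<bar>2 * c - a - b\<bar>"
  have e: "\<sigma> * e = a + b - 2 * c" by (simp add: e_def \<sigma>_def)
  define r where "r = sqrt (e\<^sup>2 + (b - a)\<^sup>2)"
  have r: "r\<^sup>2 = e\<^sup>2 + (b - a)\<^sup>2" "0 \<le> r" by (auto simp: r_def)
  \<comment> \<open>Eliminating \<open>m\<close>, \<open>p\<close>, \<open>q\<close> with p + q = 1
    leaves M^2 - 2 e M - (b - a)^2 = 0, whose larger root this is.\<close>
  define M where "M = e + r"
  define m where "m = (a + b - \<sigma> * M) / 2"
  have e0: "0 \<le> e" by (simp add: e_def)
  have M0: "0 \<le> M" using e0 r by (simp add: M_def)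
  have MM: "M\<^sup>2 - (b - a)\<^sup>2 = 2 * e * M"
    using r(1) by (simp add: M_def power2_eq_square algebra_simps)
  have "\<bar>b - a\<bar> \<le> r"
    by (rule power2_le_imp_le) (use r in auto)
  then have dM: "\<bar>b - a\<bar> \<le> M" using e0 by (simp add: M_def)
  \<comment> \<open>For \<sigma> = 1 the claim amounts to r <= 2 c, and squaring turns this into
    \<open>conv\<close>.\<close>
  have m0: "0 \<le> m"
  proof (cases "\<sigma> = 1")
    case True
    have "r\<^sup>2 \<le> (2 * c)\<^sup>2"
    proof -
      have e': "e = a + b - 2 * c" using e by (simp add: True)
      show ?thesis
        unfolding r(1) e' using conv by (simp add: power2_eq_square algebra_simps)
    qed
    then have "r \<le> 2 * c" by (rule power2_le_imp_le) (use c in simp)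
    then show ?thesis using e by (simp add: m_def M_def True)
  next
    case False
    then show ?thesis using \<sigma> a b M0 by (simp add: m_def)
  qed
  show ?thesis
  \<comment> \<open>Here a = b = c and the slope is constant, so any two widths with sum 1
    serve.\<close>
  proof (cases "M = 0")
    case True
    then have "a = b" "c = a" using dM e e0 r by (auto simp: M_def add_nonneg_eq_0_iff)
    then show ?thesis
      using a by (intro that[of 1 0 a "1/2" "1/2"]) auto
  next
    case False
    then have M: "0 < M" using M0 by simp
    \<comment> \<open>Both widths solve p + q = 1 and a - b = \<sigma> M (p - q).\<close>
    define p where "p = (M + \<sigma> * (a - b)) / (2 * M)"
    define q where "q = (M - \<sigma> * (a - b)) / (2 * M)"
    have pq: "p + q = 1" using M by (simp add: p_def q_def flip: add_divide_distrib)
    have "0 \<le> p" "0 \<le> q" using \<sigma> dM M by (auto simp: p_def q_def)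
    moreover have Mp: "M * p = (M + \<sigma> * (a - b)) / 2" and Mq: "M * q = (M - \<sigma> * (a - b)) / 2"
      using M by (simp_all add: p_def q_def)
    then have "a = m + \<sigma> * M * p" "b = m + \<sigma> * M * q"
      using \<sigma> by (auto simp: m_def field_simps)
    moreover have "c = m + \<sigma> * M * (p\<^sup>2 + q\<^sup>2) / 2"
    proof -
      have "M * (M * (p\<^sup>2 + q\<^sup>2)) = (M * p)\<^sup>2 + (M * q)\<^sup>2"
        by (simp add: power2_eq_square algebra_simps)
      also have "\<dots> = (M\<^sup>2 + (b - a)\<^sup>2) / 2"
        unfolding Mp Mq using \<sigma> by (auto simp: power2_eq_square field_simps)
      also have "\<dots> = M * (M - e)"
      proof -
        have "(b - a)\<^sup>2 = M\<^sup>2 - 2 * e * M" using MM by simp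
        then have "(M\<^sup>2 + (b - a)\<^sup>2) / 2 = M\<^sup>2 - e * M" by simp
        then show ?thesis by (simp only: power2_eq_square right_diff_distrib mult.commute)
      qed
      finally have "M * (p\<^sup>2 + q\<^sup>2) = M - e" using M by simp
      then have "m + \<sigma> * M * (p\<^sup>2 + q\<^sup>2) / 2 = m + \<sigma> * (M - e) / 2"
        by (simp add: mult.assoc)
      also have "\<dots> = c" using e by (simp add: m_def algebra_simps diff_divide_distrib add_divide_distrib)
      finally show ?thesis by simp
    qed
    ultimately show ?thesis
      using pq \<sigma> M0 m0 by (intro that[of \<sigma> M m p q]) auto
  qed
qed

section \<open>Transfer to the closed unit interval and conclusion\<close>

lemma C2_on01I:
  assumes G: "\<And>x. (G has_real_derivative U x) (at x)" and U: "\<And>x. (U has_real_derivative V x) (at x)"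
    and V: "continuous_on UNIV V"
  shows "C2_on01 G" and "\<And>x. x \<in> {0..1} \<Longrightarrow> deriv01 G x = U x"
    and "\<And>x. x \<in> {0..1} \<Longrightarrow> deriv01 (deriv01 G) x = V x"
proof -
  show d1: "deriv01 G x = U x" if "x \<in> {0..1}" for x
    by (rule deriv01_eqI[OF has_field_derivative_at_within[OF G] that])
  have U': "(deriv01 G has_real_derivative V x) (at x within {0..1})" if "x \<in> {0..1}" for x
    using has_field_derivative_at_within[OF U]
    by (rule has_field_derivative_transform_within[of _ _ _ _ 1]) (use that d1 in auto)
  show d2: "deriv01 (deriv01 G) x = V x" if "x \<in> {0..1}" for x
    using deriv01_eqI[OF U'[OF that] that] .
  have "continuous_on {0..1} (deriv01 (deriv01 G))"
    by (subst continuous_on_cong[OF refl d2]) (use continuous_on_subset[OF V] in auto)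
  moreover have "G differentiable_on {0..1}"
    unfolding differentiable_on_def real_differentiable_def
    using G has_field_derivative_at_within by blast
  moreover have "deriv01 G differentiable_on {0..1}"
    unfolding differentiable_on_def real_differentiable_def using U' by blast
  ultimately show "C2_on01 G" by (simp add: C2_on01_def)
qed

lemma Linf_norm01_le:
  assumes "continuous_on {0..1} f" "\<And>x. x \<in> {0..1} \<Longrightarrow> \<bar>f x\<bar> \<le> B"
  shows "Linf_norm01 f \<le> ennreal B"
proof -
  \<comment> \<open>Measurability matters because \<open>esssup\<close> is infinite by convention on
    non-measurable functions.\<close>
  have "f \<in> borel_measurable (lebesgue_on {0..1})"
    using assms(1) by (rule continuous_imp_measurable_on_sets_lebesgue) simp
  then show ?thesis
    unfolding Linf_norm01_def
    by (intro esssup_I) (use assms(2) in \<open>auto intro!: AE_I2 ennreal_leI\<close>)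
qed

theorem theorem5p1:
  fixes a b c :: real
  assumes "0 \<le> a" and "0 \<le> b" and "0 < c"
  shows "\<exists>G. C2_on01 G \<and> G 0 = 0 \<and> G 1 = c \<and> deriv01 G 0 = a \<and> deriv01 G 1 = b \<and>
           (\<forall>x\<in>{0..1}. 0 \<le> deriv01 G x) \<and>
           Linf_norm01 (deriv01 (deriv01 G)) \<le> ennreal (1 + 0.2) * Mstar a b c"
proof -
  obtain \<sigma> M m p q where \<sigma>: "\<sigma> = 1 \<or> \<sigma> = -1" and M: "0 \<le> M" and m: "0 \<le> m"
    and pq: "0 \<le> p" "0 \<le> q" "p + q \<le> 1" "0 < p + q" and gap: "p + q = 1 \<or> \<sigma> = 1 \<and> m = 0"
    and abc: "a = m + \<sigma> * M * p" "b = m + \<sigma> * M * q" "c = m + \<sigma> * M * (p\<^sup>2 + q\<^sup>2) / 2"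
    using extremal_parameters[OF assms] by blast
  obtain G U V where G: "\<And>x. (G has_real_derivative U x) (at x)"
    and U: "\<And>x. (U has_real_derivative V x) (at x)" and V: "continuous_on UNIV V"
    and ends: "G 0 = 0" "G 1 = c" "U 0 = a" "U 1 = b"
    and bounds: "\<forall>x\<in>{0..1}. 0 \<le> U x \<and> \<bar>V x\<bar> \<le> 6/5 * M"
    using C2_competitor[OF \<sigma> M m pq(1,2,3) gap abc(1) assms(1) abc(2) assms(2) abc(3)] by blast
  note C2 = C2_on01I[OF G U V]
  have "Linf_norm01 (deriv01 (deriv01 G)) \<le> ennreal (6/5 * M)"
  proof (rule Linf_norm01_le)
    show "continuous_on {0..1} (deriv01 (deriv01 G))" using C2(1) by (simp add: C2_on01_def)
  qed (use C2(3) bounds in simp)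
  also have "\<dots> = ennreal (1 + 0.2) * ennreal M"
    using M by (simp flip: ennreal_mult)
  also have "\<dots> \<le> ennreal (1 + 0.2) * Mstar a b c"
    by (intro mult_left_mono Mstar_lower_bound[OF \<sigma> pq gap abc]) simp
  finally show ?thesis
    using C2 ends bounds by (intro exI[of _ G]) simp
qed

end
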